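(* Let $M$ be an indecomposable $n\times n$ binary matrix with period $d$ and index $\gamma$, let $G$ be the digraph with adjacency matrix $M$ (that is, the underlying digraph of the level poset $P$ of $M$), and let $<$ be a linear order on the vertex set $V$ of $G$. Then $<$ is a vertex shelling order for $G$ if and only if the vertex shelling condition $(S_k)$ holds for all $k\le \gamma+d$, where $(S_k)$ is the following condition: for any $u,v\in V$ and every pair of walks $u=v_0\to v_1\to\cdots\to v_k=v$ and $u=v_0'\to v_1'\to\cdots\to v_k'=v$ of length $k$ in $G$ with $v_1'<v_1$, there are a $j\in\{1,\dots,k-1\}$ and a vertex $w\in V$ such that $w<v_j$ and both $v_{j-1}\to w$ and $w\to v_{j+1}$ are edges of $G$.
   Context: A linear order $<$ on the vertex set of a digraph $G$ is a vertex shelling order if condition $(S_k)$ of the claim holds for every $k\ge1$. For a square matrix $A$ with nonnegative entries, $\operatorname{Bin}(A)$ is the $0/1$ matrix obtained by replacing each nonzero entry of $A$ by $1$. A nonnegative square matrix $M$ is indecomposable if for all $i,j$ there is $t>0$ with $(M^t)_{i,j}>0$. Its period $d$ is the greatest common divisor of all positive integers $k$ with $(M^k)_{i,i}>0$ (independent of $i$). Its index $\gamma$ is the smallest nonnegative integer such that $\operatorname{Bin}(M^{t+d})=\operatorname{Bin}(M^{t})$ for all $t\ge\gamma$. The digraph with adjacency matrix $M$ has an edge $u\to v$ exactly when $M_{u,v}=1$ (loops allowed). *)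

theory Defs
  imports
    "Jordan_Normal_Form.Matrix"
    "Graph_Theory.Vertex_Walk"
    "Graph_Theory.Pair_Digraph"
begin

text \<open>
  Matrices are those of Jordan Normal Form, with rows and columns indexed by \<open>0, \<dots>, n - 1\<close>;
  \<open>A ^\<^sub>m 0\<close> is the identity matrix.
\<close>

definition binary_mat :: "'a::zero_neq_one mat \<Rightarrow> bool" where
  "binary_mat A \<longleftrightarrow> elements_mat A \<subseteq> {0, 1}"

definition Bin :: "'a::zero_neq_one mat \<Rightarrow> 'a mat" where
  "Bin A = map_mat (\<lambda>x. if x = 0 then 0 else 1) A"

definition indecomposable_mat :: "'a::linordered_semidom mat \<Rightarrow> bool" where
  "indecomposable_mat A \<longleftrightarrow> square_mat A \<and> (\<forall>x \<in> elements_mat A. 0 \<le> x) \<and>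
     (\<forall>i < dim_row A. \<forall>j < dim_row A. \<exists>t > 0. (A ^\<^sub>m t) $$ (i, j) > 0)"

text \<open>
  The period is computed at an index \<open>i\<close>, on which it does not depend if the matrix is
  indecomposable.
\<close>

definition mat_period :: "'a::linordered_semidom mat \<Rightarrow> nat \<Rightarrow> nat" where
  "mat_period A i = Gcd {k. 0 < k \<and> (A ^\<^sub>m k) $$ (i, i) > 0}"

definition mat_index :: "'a::linordered_semidom mat \<Rightarrow> nat \<Rightarrow> nat" where
  "mat_index A d = (LEAST \<gamma>. \<forall>t \<ge> \<gamma>. Bin (A ^\<^sub>m (t + d)) = Bin (A ^\<^sub>m t))"

definition adj_digraph :: "'a::zero_neq_one mat \<Rightarrow> nat pair_pre_digraph" where
  "adj_digraph A =
     \<lparr> pverts = {..<dim_row A},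
       parcs = {(u, v). u < dim_row A \<and> v < dim_row A \<and> A $$ (u, v) = 1} \<rparr>"

text \<open>
  A linear order is given by its strict part \<open>r\<close>, so \<open>(x, y) \<in> r\<close> stands for \<open>x < y\<close>.
  It is not related to the usual order on \<open>nat\<close>. A walk of length \<open>k\<close> is the list of its
  \<open>k + 1\<close> vertices.
\<close>

definition linear_order_of_verts :: "('a, 'b) pre_digraph \<Rightarrow> 'a rel \<Rightarrow> bool" where
  "linear_order_of_verts G r \<longleftrightarrow>
     r \<subseteq> verts G \<times> verts G \<and> strict_linear_order_on (verts G) r"

definition vertex_shelling_cond :: "('a, 'b) pre_digraph \<Rightarrow> 'a rel \<Rightarrow> nat \<Rightarrow> bool" where
  "vertex_shelling_cond G r k \<longleftrightarrow>
     (\<forall>u \<in> verts G. \<forall>v \<in> verts G. \<forall>p p'.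
        vwalk p G \<and> vwalk_length p = k \<and> hd p = u \<and> last p = v \<and>
        vwalk p' G \<and> vwalk_length p' = k \<and> hd p' = u \<and> last p' = v \<and>
        (p' ! 1, p ! 1) \<in> r \<longrightarrow>
        (\<exists>j \<in> {1..<k}. \<exists>w \<in> verts G.
           (w, p ! j) \<in> r \<and> p ! (j - 1) \<rightarrow>\<^bsub>G\<^esub> w \<and> w \<rightarrow>\<^bsub>G\<^esub> p ! (j + 1)))"

definition vertex_shelling_order :: "('a, 'b) pre_digraph \<Rightarrow> 'a rel \<Rightarrow> bool" where
  "vertex_shelling_order G r \<longleftrightarrow>
     linear_order_of_verts G r \<and> (\<forall>k \<ge> 1. vertex_shelling_cond G r k)"

end

(* Beyond the index gamma, whether there is a walk of length t from x to y depends only on t modulo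
   the period d. Let two walks of length k > gamma + d from u to v be given. Walks from v back to the
   vertex y reached by the first walk after k - d steps have length divisible by d, so the second
   walk can be replaced by one of length k - d with the same first step that ends in y. The
   condition for k - d, applied to the new walk and the first k - d steps of the old one, gives the
   condition for k. That the index exists at all is the Frobenius coin property of the set of
   lengths of closed walks. *)

theory Submission
  imports Defs
begin

section \<open>Additive monoids of natural numbers\<close>

text \<open>The least positive difference \<open>e\<close> of two elements of \<open>S\<close> turns
  out to be \<open>Gcd S\<close>. Two elements \<open>y\<close> and \<open>y + e\<close> realizing
  it already generate all large multiples of \<open>e\<close>.\<close>

lemma additive_monoid_contains_large_multiples_of_Gcd:
  fixes S :: "nat set"
  assumes zero: "0 \<in> S" and add: "\<And>x y. x \<in> S \<Longrightarrow> y \<in> S \<Longrightarrow> x + y \<in> S"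
  shows "\<exists>N. \<forall>t\<ge>N. t * Gcd S \<in> S"
proof (cases "S \<subseteq> {0}")
  case True
  with zero have "S = {0}" by auto
  then show ?thesis by simp
next
  case False
  then obtain s where s: "s \<in> S" "s > 0" by auto
  have mult: "q * x \<in> S" if "x \<in> S" for q x
    using that by (induction q) (auto intro: zero add)
  \<comment> \<open>\<open>S\<close> need not be closed under subtraction, so the Euclidean argument
    runs on the differences of elements of \<open>S\<close>.\<close>
  define D where "D e \<longleftrightarrow> 0 < e \<and> (\<exists>y \<in> S. y + e \<in> S)" for e
  define e where "e = (LEAST e. D e)"
  have "D s" using s zero unfolding D_def by (auto intro!: bexI[of _ 0])
  then have De: "D e" unfolding e_def by (rule LeastI)
  then obtain y where y: "y \<in> S" "y + e \<in> S" and e0: "0 < e" unfolding D_def by blast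
  \<comment> \<open>Otherwise \<open>x mod e\<close> would be a smaller positive difference, namely
    that of \<open>x + (x div e) * y\<close> and \<open>(x div e) * (y + e)\<close>.\<close>
  have "e dvd x" if "x \<in> S" for x
  proof (rule ccontr)
    assume "\<not> e dvd x"
    then have "0 < x mod e" by (simp add: mod_greater_zero_iff_not_dvd)
    moreover have "(x div e) * (y + e) + x mod e = x + (x div e) * y"
      by (simp add: algebra_simps)
    with that y have "(x div e) * (y + e) + x mod e \<in> S"
      by (auto intro: add mult)
    ultimately have "D (x mod e)" using mult[OF y(2)] unfolding D_def by blast
    then have "e \<le> x mod e" unfolding e_def by (rule Least_le)
    with mod_less_divisor[OF e0, of x] show False by simp
  qed
  then have "e dvd Gcd S" by (rule Gcd_greatest)
  moreover have "Gcd S dvd e"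
    using Gcd_dvd[OF y(1)] Gcd_dvd[OF y(2)] by (simp add: dvd_add_right_iff)
  ultimately have eG: "Gcd S = e" by (simp add: dvd_antisym)
  obtain m where m: "y = m * e" using Gcd_dvd[OF y(1)] eG by (metis dvd_def mult.commute)
  \<comment> \<open>For \<open>m > 0\<close> the bound \<open>m * m\<close> makes the quotient of
    \<open>t\<close> by \<open>m\<close> at least \<open>m\<close>, hence at least the remainder.
    Their difference \<open>c\<close> is then the number of copies of \<open>y\<close>, next to
    \<open>t mod m\<close> copies of \<open>y + e\<close>.\<close>
  have "t * e \<in> S" if t: "t \<ge> m * m" for t
  proof (cases "m = 0")
    case True
    with m y mult show ?thesis by simp
  next
    case False
    have "t mod m \<le> t div m"
      using False t by (metis div_le_mono less_or_eq_imp_le mod_less_divisor nonzero_mult_div_cancel_left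
          order_trans bot_nat_0.not_eq_extremum)
    moreover have "t = t div m * m + t mod m" by simp
    ultimately obtain c where c: "t div m = t mod m + c" "t = (t mod m + c) * m + t mod m"
      using le_Suc_ex by metis
    have "t * e = ((t mod m + c) * m + t mod m) * e" using c(2) by metis
    also have "\<dots> = (t mod m) * (y + e) + c * y"
      unfolding m by (simp add: algebra_simps)
    finally show ?thesis using y by (auto intro: add mult)
  qed
  then show ?thesis unfolding eG by blast
qed

section \<open>Zero patterns of powers of nonnegative matrices\<close>

lemma Bin_eqD:
  assumes "Bin A = Bin B" "i < dim_row A" "j < dim_col A"
  shows "A $$ (i, j) = 0 \<longleftrightarrow> B $$ (i, j) = 0"
proof -
  have "dim_row A = dim_row B" "dim_col A = dim_col B"
    using arg_cong[OF assms(1), of dim_row] arg_cong[OF assms(1), of dim_col]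
    by (simp_all add: Bin_def)
  moreover have "Bin A $$ (i, j) = Bin B $$ (i, j)" using assms(1) by simp
  ultimately show ?thesis using assms(2,3) by (simp add: Bin_def split: if_splits)
qed

lemma pow_mat_add:
  assumes "A \<in> carrier_mat n n"
  shows "A ^\<^sub>m (s + t) = A ^\<^sub>m s * A ^\<^sub>m t"
proof (induction t)
  case 0
  from assms show ?case using right_mult_one_mat[OF pow_carrier_mat[OF assms], of s] by auto
next
  case (Suc t)
  from assms show ?case
    by (simp add: Suc assoc_mult_mat[OF pow_carrier_mat pow_carrier_mat])
qed

context
  fixes A :: "'a::linordered_semidom mat" and n :: nat
  assumes carrier: "A \<in> carrier_mat n n"
    and nonneg: "\<And>i j. i < n \<Longrightarrow> j < n \<Longrightarrow> 0 \<le> A $$ (i, j)"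
begin

lemma pow_mat_nonneg: "i < n \<Longrightarrow> j < n \<Longrightarrow> 0 \<le> (A ^\<^sub>m t) $$ (i, j)"
proof (induction t arbitrary: i j)
  case 0
  then show ?case using carrier by auto
next
  case (Suc t)
  then show ?case using carrier nonneg
    by (auto simp: scalar_prod_def intro!: sum_nonneg mult_nonneg_nonneg)
qed

text \<open>Nonnegative terms cannot cancel, so the sum for the matrix product is positive as soon
  as one term is. In terms of walks, \<open>w\<close> is the vertex reached after \<open>s\<close>
  of the \<open>s + t\<close> steps.\<close>

lemma pow_mat_add_pos_iff:
  assumes "i < n" "j < n"
  shows "0 < (A ^\<^sub>m (s + t)) $$ (i, j) \<longleftrightarrow>
    (\<exists>w<n. 0 < (A ^\<^sub>m s) $$ (i, w) \<and> 0 < (A ^\<^sub>m t) $$ (w, j))"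
proof -
  have dims: "dim_row (A ^\<^sub>m s) = n" "dim_col (A ^\<^sub>m s) = n" "dim_row (A ^\<^sub>m t) = n"
    "dim_col (A ^\<^sub>m t) = n"
    using carrier by auto
  have eq: "(A ^\<^sub>m (s + t)) $$ (i, j) = (\<Sum>w<n. (A ^\<^sub>m s) $$ (i, w) * (A ^\<^sub>m t) $$ (w, j))"
    unfolding pow_mat_add[OF carrier] using assms dims
    by (simp add: scalar_prod_def lessThan_atLeast0)
  have "0 < (\<Sum>w<n. (A ^\<^sub>m s) $$ (i, w) * (A ^\<^sub>m t) $$ (w, j)) \<longleftrightarrow>
    (\<exists>w<n. (A ^\<^sub>m s) $$ (i, w) * (A ^\<^sub>m t) $$ (w, j) \<noteq> 0)"
    using assms pow_mat_nonneg
    by (subst less_le, subst sum_nonneg, simp, subst eq_commute, subst sum_nonneg_eq_0_iff) auto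
  then show ?thesis unfolding eq using assms pow_mat_nonneg by (auto simp: less_le)
qed

lemma pow_mat_pos_trans:
  assumes "0 < (A ^\<^sub>m s) $$ (i, w)" "0 < (A ^\<^sub>m t) $$ (w, j)" "i < n" "w < n" "j < n"
  shows "0 < (A ^\<^sub>m (s + t)) $$ (i, j)"
  using assms pow_mat_add_pos_iff by blast

text \<open>Iterates the index equation, so that any multiple of \<open>d\<close> can be removed
  from a length at once, provided at least \<open>\<gamma>\<close> remains.\<close>

lemma pow_mat_pos_periodic:
  assumes "\<forall>t\<ge>\<gamma>. Bin (A ^\<^sub>m (t + d)) = Bin (A ^\<^sub>m t)" "\<gamma> \<le> t" "i < n" "j < n"
  shows "0 < (A ^\<^sub>m (t + a * d)) $$ (i, j) \<longleftrightarrow> 0 < (A ^\<^sub>m t) $$ (i, j)"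
proof (induction a)
  case 0
  show ?case by simp
next
  case (Suc a)
  let ?t = "t + a * d"
  have "Bin (A ^\<^sub>m (?t + d)) = Bin (A ^\<^sub>m ?t)" using assms(1,2) by simp
  then have "(A ^\<^sub>m (?t + d)) $$ (i, j) = 0 \<longleftrightarrow> (A ^\<^sub>m ?t) $$ (i, j) = 0"
    by (rule Bin_eqD) (use assms carrier in auto)
  with Suc pow_mat_nonneg[OF assms(3,4)] show ?case by (auto simp: less_le algebra_simps)
qed

section \<open>Period and index of an irreducible matrix\<close>

context
  assumes irreducible: "\<And>i j. i < n \<Longrightarrow> j < n \<Longrightarrow> \<exists>t>0. 0 < (A ^\<^sub>m t) $$ (i, j)"
begin

lemma mat_period_pos:
  assumes "i < n"
  shows "0 < mat_period A i"
  using irreducible[OF assms assms] unfolding mat_period_def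
  by (metis (mono_tags, lifting) Gcd_0_iff empty_iff gr0I less_irrefl mem_Collect_eq singletonD subsetD)

text \<open>Inserting the closed walk at \<open>j\<close> into a round trip from \<open>i\<close>
  through \<open>j\<close> gives closed walks at \<open>i\<close> of lengths \<open>a + b\<close>
  and \<open>a + c + b\<close>. The period divides both, hence their difference
  \<open>c\<close>.\<close>

lemma mat_period_dvd:
  assumes "i < n" "j < n" "0 < (A ^\<^sub>m c) $$ (j, j)"
  shows "mat_period A i dvd c"
proof -
  obtain a where a: "0 < a" "0 < (A ^\<^sub>m a) $$ (i, j)" using irreducible assms by blast
  obtain b where b: "0 < b" "0 < (A ^\<^sub>m b) $$ (j, i)" using irreducible assms by blast
  have "0 < (A ^\<^sub>m (a + b)) $$ (i, i)" "0 < (A ^\<^sub>m (a + c + b)) $$ (i, i)"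
    using assms a b by (blast intro: pow_mat_pos_trans)+
  then have "mat_period A i dvd a + b" "mat_period A i dvd a + c + b"
    unfolding mat_period_def using a b by (auto intro!: Gcd_dvd)
  moreover have "a + c + b = a + b + c" by simp
  ultimately show ?thesis by (metis dvd_add_right_iff)
qed

lemma mat_period_eq:
  assumes "i < n" "j < n"
  shows "mat_period A i = mat_period A j"
proof (rule dvd_antisym)
  show "mat_period A i dvd mat_period A j"
    unfolding mat_period_def[of A j] using mat_period_dvd assms by (blast intro: Gcd_greatest)
  show "mat_period A j dvd mat_period A i"
    unfolding mat_period_def[of A i] using mat_period_dvd assms by (blast intro: Gcd_greatest)
qed

lemma eventually_closed_walks:
  assumes "i < n"
  shows "\<exists>N. \<forall>t\<ge>N. 0 < (A ^\<^sub>m (t * mat_period A i)) $$ (i, i)"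
proof -
  let ?S = "{k. 0 < (A ^\<^sub>m k) $$ (i, i)}"
  \<comment> \<open>The period is taken over positive lengths only; adding 0 makes the set a monoid
    and leaves its Gcd unchanged.\<close>
  have "?S = insert 0 {k. 0 < k \<and> 0 < (A ^\<^sub>m k) $$ (i, i)}"
    using assms carrier by auto
  then have "Gcd ?S = mat_period A i" unfolding mat_period_def by simp
  moreover have "\<exists>N. \<forall>t\<ge>N. t * Gcd ?S \<in> ?S"
  proof (rule additive_monoid_contains_large_multiples_of_Gcd)
    show "0 \<in> ?S" using assms carrier by simp
    show "x + y \<in> ?S" if "x \<in> ?S" "y \<in> ?S" for x y
      using that assms by (auto intro: pow_mat_pos_trans)
  qed
  ultimately show ?thesis by simp
qed

text \<open>All lengths of walks from \<open>i\<close> to \<open>j\<close> are congruent modulo the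
  period, since one return walk closes all of them. A large \<open>t\<close> in this class is
  realized by a long closed walk at \<open>i\<close> followed by a fixed walk of length
  \<open>a\<close>. The bound does not depend on \<open>s\<close>.\<close>

lemma eventually_walks:
  assumes "i < n" "j < n"
  shows "\<exists>N. \<forall>t\<ge>N. \<forall>s. 0 < (A ^\<^sub>m s) $$ (i, j) \<longrightarrow> mat_period A i dvd t - s \<longrightarrow> s \<le> t \<longrightarrow>
    0 < (A ^\<^sub>m t) $$ (i, j)"
proof -
  let ?d = "mat_period A i"
  obtain N where N: "\<And>t. t \<ge> N \<Longrightarrow> 0 < (A ^\<^sub>m (t * ?d)) $$ (i, i)"
    using eventually_closed_walks assms by blast
  obtain a where a: "0 < (A ^\<^sub>m a) $$ (i, j)" using irreducible assms by blast
  obtain b where b: "0 < (A ^\<^sub>m b) $$ (j, i)" using irreducible assms by blast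
  have "0 < (A ^\<^sub>m t) $$ (i, j)"
    if t: "t \<ge> N * ?d + a" and s: "0 < (A ^\<^sub>m s) $$ (i, j)" "?d dvd t - s" "s \<le> t" for t s
  proof -
    have "?d dvd a + b" "?d dvd s + b"
      using a b s assms by (blast intro: mat_period_dvd pow_mat_pos_trans)+
    moreover have "(t - a) + (a + b) = (t - s) + (s + b)" using t s by simp
    ultimately have "?d dvd t - a" using s(2) by (metis dvd_add dvd_add_left_iff)
    then obtain c where c: "t - a = c * ?d" by (metis dvdE mult.commute)
    have "N * ?d \<le> c * ?d" using c t by linarith
    then have "N \<le> c" using mat_period_pos assms by simp
    then have "0 < (A ^\<^sub>m (c * ?d + a)) $$ (i, j)" using N a assms by (blast intro: pow_mat_pos_trans)
    moreover have "c * ?d + a = t" using c t by linarith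
    ultimately show ?thesis by simp
  qed
  then show ?thesis by blast
qed

text \<open>Without this, the \<open>LEAST\<close> in \<open>mat_index\<close> would carry no
  information. Each entry of the powers has its own threshold, and the maximum over the finitely
  many entries serves all of them.\<close>

lemma mat_index_exists:
  assumes "i < n"
  shows "\<exists>\<gamma>. \<forall>t\<ge>\<gamma>. Bin (A ^\<^sub>m (t + mat_period A i)) = Bin (A ^\<^sub>m t)"
proof -
  let ?d = "mat_period A i"
  have "\<exists>N. \<forall>t\<ge>N. 0 < (A ^\<^sub>m (t + ?d)) $$ (x, y) \<longleftrightarrow> 0 < (A ^\<^sub>m t) $$ (x, y)"
    if xy: "x < n" "y < n" for x y
  proof -
    obtain c where c: "c > 0" "0 < (A ^\<^sub>m c) $$ (x, y)" using irreducible xy by blast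
    obtain N where N: "\<And>t s. \<lbrakk>t \<ge> N; 0 < (A ^\<^sub>m s) $$ (x, y); ?d dvd t - s; s \<le> t\<rbrakk> \<Longrightarrow>
        0 < (A ^\<^sub>m t) $$ (x, y)"
      using eventually_walks[OF xy] mat_period_eq[OF assms xy(1)] by auto
    obtain b where b: "0 < (A ^\<^sub>m b) $$ (y, x)" using irreducible xy by blast
    \<comment> \<open>Going up, the walk of length \<open>t\<close> itself is the reference. Going
      down, it is the fixed walk of length \<open>c\<close>: closing it and the walk of length
      \<open>t + ?d\<close> by the same return walk shows that \<open>?d\<close> divides
      \<open>t - c\<close>. The summand \<open>c\<close> in the bound ensures
      \<open>c \<le> t\<close>.\<close>
    have "0 < (A ^\<^sub>m (t + ?d)) $$ (x, y) \<longleftrightarrow> 0 < (A ^\<^sub>m t) $$ (x, y)" if t: "t \<ge> N + c" for t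
    proof
      assume "0 < (A ^\<^sub>m t) $$ (x, y)"
      then show "0 < (A ^\<^sub>m (t + ?d)) $$ (x, y)" using t by (auto intro: N[of _ t])
    next
      assume "0 < (A ^\<^sub>m (t + ?d)) $$ (x, y)"
      then have "?d dvd t + ?d + b" "?d dvd c + b"
        using c b xy assms by (blast intro: mat_period_dvd pow_mat_pos_trans)+
      moreover have "t + ?d + b = (t - c) + ?d + (c + b)" using t by simp
      ultimately have "?d dvd t - c" by (metis dvd_add_left_iff dvd_refl)
      then show "0 < (A ^\<^sub>m t) $$ (x, y)" using t c by (auto intro: N[of _ c])
    qed
    then show ?thesis by blast
  qed
  then obtain N where N: "\<And>x y t. \<lbrakk>x < n; y < n; t \<ge> N x y\<rbrakk> \<Longrightarrow>
      0 < (A ^\<^sub>m (t + ?d)) $$ (x, y) \<longleftrightarrow> 0 < (A ^\<^sub>m t) $$ (x, y)"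
    by metis
  define \<gamma> where "\<gamma> = Max (case_prod N ` ({..<n} \<times> {..<n}))"
  have \<gamma>: "N x y \<le> \<gamma>" if "x < n" "y < n" for x y
    unfolding \<gamma>_def using that by (intro Max_ge) auto
  have "Bin (A ^\<^sub>m (t + ?d)) = Bin (A ^\<^sub>m t)" if t: "t \<ge> \<gamma>" for t
  proof (rule eq_matI)
    fix x y
    assume "x < dim_row (Bin (A ^\<^sub>m t))" "y < dim_col (Bin (A ^\<^sub>m t))"
    then have xy: "x < n" "y < n" using carrier by (auto simp: Bin_def split: if_splits)
    have "(A ^\<^sub>m (t + ?d)) $$ (x, y) = 0 \<longleftrightarrow> (A ^\<^sub>m t) $$ (x, y) = 0"
      using N[OF xy] \<gamma>[OF xy] t pow_mat_nonneg[OF xy] by (metis less_le order_trans)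
    then show "Bin (A ^\<^sub>m (t + ?d)) $$ (x, y) = Bin (A ^\<^sub>m t) $$ (x, y)"
      using xy carrier by (simp add: Bin_def)
  qed (use carrier in \<open>auto simp: Bin_def\<close>)
  then show ?thesis by blast
qed

lemma mat_index_periodic:
  assumes "i < n" "d = mat_period A i"
  shows "\<forall>t\<ge>mat_index A d. Bin (A ^\<^sub>m (t + d)) = Bin (A ^\<^sub>m t)"
  unfolding mat_index_def using mat_index_exists[OF assms(1)] unfolding assms(2) by (rule LeastI_ex)

end

end

section \<open>Walks in the digraph as positive entries of matrix powers\<close>

lemma vwalk_iff_nth:
  "vwalk p G \<longleftrightarrow> p \<noteq> [] \<and> (\<forall>x<length p. p ! x \<in> verts G) \<and>
     (\<forall>x. Suc x < length p \<longrightarrow> (p ! x, p ! Suc x) \<in> arcs_ends G)"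
proof (induction p)
  case Nil
  show ?case by (simp add: vwalk_def)
next
  case (Cons a p)
  show ?case
  proof (cases p)
    case Nil
    then show ?thesis by (auto simp: vwalk_def)
  next
    case (Cons b q)
    have "vwalk (a # p) G \<longleftrightarrow> a \<in> verts G \<and> (a, b) \<in> arcs_ends G \<and> vwalk p G"
      using Cons by (auto simp: vwalk_def)
    with Cons.IH Cons show ?thesis by (auto simp: nth_Cons all_conj_distrib split: nat.splits)
  qed
qed

context
  fixes M :: "real mat" and n :: nat
  assumes carrier: "M \<in> carrier_mat n n" and binary: "binary_mat M"
begin

lemma binary_cases: "i < n \<Longrightarrow> j < n \<Longrightarrow> M $$ (i, j) = 0 \<or> M $$ (i, j) = 1"
  using binary elements_matI[OF carrier] unfolding binary_mat_def by blast

lemma binary_nonneg: "i < n \<Longrightarrow> j < n \<Longrightarrow> 0 \<le> M $$ (i, j)"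
  using binary_cases[of i j] by auto

text \<open>Edges are written with \<open>M ^\<^sub>m 1\<close> so that single steps fit the lemmas
  about powers. For binary entries, being positive and being 1 are the same.\<close>

lemma vwalk_adj_digraph_iff:
  "vwalk p (with_proj (adj_digraph M)) \<longleftrightarrow> p \<noteq> [] \<and> (\<forall>x<length p. p ! x < n) \<and>
     (\<forall>x. Suc x < length p \<longrightarrow> 0 < (M ^\<^sub>m 1) $$ (p ! x, p ! Suc x))"
proof -
  have "(x, y) \<in> arcs_ends (with_proj (adj_digraph M)) \<longleftrightarrow> 0 < (M ^\<^sub>m 1) $$ (x, y)"
    if "x < n" "y < n" for x y
    using that carrier binary_cases[of x y] by (auto simp: adj_digraph_def)
  moreover have "verts (with_proj (adj_digraph M)) = {..<n}"
    using carrier by (auto simp: adj_digraph_def)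
  ultimately show ?thesis unfolding vwalk_iff_nth by (metis Suc_lessD lessThan_iff)
qed

text \<open>Stated for an arbitrary segment, since the final \<open>d\<close> steps of one walk and
  all but the first step of another are needed later.\<close>

lemma vwalk_imp_pow_mat_pos:
  assumes "vwalk p (with_proj (adj_digraph M))" "a + t < length p"
  shows "0 < (M ^\<^sub>m t) $$ (p ! a, p ! (a + t))"
  using assms(2)
proof (induction t)
  case 0
  with assms(1) carrier show ?case by (auto simp: vwalk_adj_digraph_iff)
next
  case (Suc t)
  with assms(1) pow_mat_pos_trans[OF carrier binary_nonneg, of t "p ! a" "p ! (a + t)" 1 "p ! (a + Suc t)"]
  show ?case by (auto simp: vwalk_adj_digraph_iff simp del: pow_mat.simps)
qed

lemma pow_mat_pos_imp_vwalk:
  assumes "0 < (M ^\<^sub>m t) $$ (u, v)" "u < n" "v < n"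
  shows "\<exists>p. vwalk p (with_proj (adj_digraph M)) \<and> length p = Suc t \<and> hd p = u \<and> last p = v"
  using assms
proof (induction t arbitrary: u)
  case 0
  then have "u = v" using carrier by (auto split: if_splits)
  with 0 show ?case by (intro exI[of _ "[u]"]) (simp add: vwalk_adj_digraph_iff)
next
  case (Suc t)
  then obtain w where w: "w < n" "0 < (M ^\<^sub>m 1) $$ (u, w)" "0 < (M ^\<^sub>m t) $$ (w, v)"
    using pow_mat_add_pos_iff[OF carrier binary_nonneg, of u v 1 t] by auto
  with Suc obtain p where p: "vwalk p (with_proj (adj_digraph M))" "length p = Suc t" "hd p = w"
    "last p = v"
    by blast
  have "M $$ (u, w) = 1" using w Suc.prems binary_cases[of u w] carrier by auto
  then have "vwalk (u # p) (with_proj (adj_digraph M))"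
    using p w Suc.prems carrier by (intro vwalk_consI) (auto simp: adj_digraph_def)
  with p show ?case by (intro exI[of _ "u # p"]) auto
qed

end

section \<open>Descent from length \<open>k\<close> to length \<open>k - d\<close>\<close>

theorem theorem6p4:
  fixes M :: "real mat" and n i d \<gamma> :: nat and r :: "nat rel"
    and G :: "(nat, nat \<times> nat) pre_digraph"
  assumes "M \<in> carrier_mat n n"
    and "binary_mat M"
    and "indecomposable_mat M"
    and "i < n" and "d = mat_period M i"
    and "\<gamma> = mat_index M d"
    and "G = with_proj (adj_digraph M)"
    and "linear_order_of_verts G r"
  shows "vertex_shelling_order G r \<longleftrightarrow>
    (\<forall>k. 1 \<le> k \<and> k \<le> \<gamma> + d \<longrightarrow> vertex_shelling_cond G r k)"
proof
  assume "vertex_shelling_order G r"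
  then show "\<forall>k. 1 \<le> k \<and> k \<le> \<gamma> + d \<longrightarrow> vertex_shelling_cond G r k"
    by (simp add: vertex_shelling_order_def)
next
  assume small: "\<forall>k. 1 \<le> k \<and> k \<le> \<gamma> + d \<longrightarrow> vertex_shelling_cond G r k"
  note carrier = assms(1)
  note nonneg = binary_nonneg[OF assms(1,2)]
  have irreducible: "\<exists>t>0. 0 < (M ^\<^sub>m t) $$ (x, y)" if "x < n" "y < n" for x y
    using that assms(1,3) by (auto simp: indecomposable_mat_def)
  note trans = pow_mat_pos_trans[OF carrier nonneg]
  have d: "0 < d" using mat_period_pos[OF carrier nonneg irreducible assms(4)] assms(5) by simp
  have dvd: "d dvd c" if "0 < (M ^\<^sub>m c) $$ (x, x)" "x < n" for c x
    using mat_period_dvd[OF carrier nonneg irreducible assms(4)] that assms(5) by blast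
  have periodic: "\<forall>t\<ge>\<gamma>. Bin (M ^\<^sub>m (t + d)) = Bin (M ^\<^sub>m t)"
    using mat_index_periodic[OF carrier nonneg irreducible assms(4,5)] assms(6) by simp
  have verts: "verts G = {..<n}" using assms(1,7) by (auto simp: adj_digraph_def)
  note vwalk_iff = vwalk_adj_digraph_iff[OF assms(1,2), folded assms(7)]
  have "vertex_shelling_cond G r k" if "1 \<le> k" for k
    using that
  proof (induction k rule: less_induct)
    case (less k)
    show ?case
    proof (cases "k \<le> \<gamma> + d")
      case True
      with small less show ?thesis by blast
    next
      case False
      \<comment> \<open>The strict inequality \<open>k > \<gamma> + d\<close> gives
        \<open>\<gamma> \<le> m - 1\<close>. This is the bound needed below, because only the
        \<open>m - 1\<close> steps after the first are replaced.\<close>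
      define m where "m = k - d"
      have m: "1 \<le> m" "m < k" "k = m + d" "\<gamma> \<le> m - 1" using False d by (auto simp: m_def)
      show ?thesis
        unfolding vertex_shelling_cond_def
      proof (intro ballI allI impI, elim conjE)
        fix u v p p'
        assume u: "u \<in> verts G" and v: "v \<in> verts G"
          and p: "vwalk p G" "vwalk_length p = k" "hd p = u" "last p = v"
          and p': "vwalk p' G" "vwalk_length p' = k" "hd p' = u" "last p' = v"
          and less1: "(p' ! 1, p ! 1) \<in> r"
        have len: "length p = Suc k" "length p' = Suc k"
          using p p' \<open>1 \<le> k\<close> by (auto simp: vwalk_iff)
        have ends: "p ! k = v" "p' ! k = v" "p ! 0 = u" "p' ! 0 = u"
          using p p' len by (auto simp: last_conv_nth hd_conv_nth vwalk_iff)
        have lt: "v < n" "p ! m < n" "p' ! 1 < n" using v p p' len m by (auto simp: verts vwalk_iff)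
        have "0 < (M ^\<^sub>m d) $$ (p ! m, v)" "0 < (M ^\<^sub>m (k - 1)) $$ (p' ! 1, v)"
          using vwalk_imp_pow_mat_pos[OF assms(1,2), of p m d]
            vwalk_imp_pow_mat_pos[OF assms(1,2), of p' 1 "k - 1"] p p' len ends m assms(7)
          by simp_all
        \<comment> \<open>The return walk serves twice: it closes the last \<open>d\<close> steps of
          \<open>p\<close> to a circuit, so \<open>d\<close> divides \<open>s + d\<close>, and it
          extends the rest of \<open>p'\<close> after its first step to end in
          \<open>p ! m\<close>.\<close>
        moreover obtain s where s: "0 < (M ^\<^sub>m s) $$ (v, p ! m)"
          using irreducible lt by blast
        ultimately have "d dvd s + d" and walk: "0 < (M ^\<^sub>m (k - 1 + s)) $$ (p' ! 1, p ! m)"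
          using lt by (blast intro: dvd trans)+
        then obtain a where a: "s + d = a * d" by (metis dvdE mult.commute)
        \<comment> \<open>The excess over \<open>m - 1\<close> is exactly the circuit length
          \<open>s + d\<close>, so periodicity removes it.\<close>
        have "k - 1 + s = m - 1 + a * d" using a m by linarith
        with walk have "0 < (M ^\<^sub>m (m - 1)) $$ (p' ! 1, p ! m)"
          using pow_mat_pos_periodic[OF carrier nonneg periodic m(4) lt(3,2)] by simp
        \<comment> \<open>A list of \<open>m\<close> vertices has \<open>m - 1\<close> steps;
          prefixing \<open>u\<close> restores the first step of \<open>p'\<close> and makes the
          length \<open>m\<close>.\<close>
        then obtain q' where q': "vwalk q' G" "length q' = m" "hd q' = p' ! 1" "last q' = p ! m"
          using pow_mat_pos_imp_vwalk[OF assms(1,2)] lt m assms(7) by fastforce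
        define q where "q = take (Suc m) p"
        have nth_q: "q ! x = p ! x" if "x \<le> m" for x using that by (simp add: q_def)
        have len_q: "length q = Suc m" using len m by (simp add: q_def)
        have "vwalk q G" using p(1) nth_q len_q len m by (auto simp: vwalk_iff simp del: pow_mat.simps)
        moreover have "hd q = u" "last q = p ! m"
          using nth_q len_q ends by (metis hd_conv_nth le0 length_0_conv nat.distinct(1),
            metis diff_Suc_1 last_conv_nth le_refl length_0_conv nat.distinct(1))
        moreover have "vwalk (u # q') G"
        proof (rule vwalk_consI[OF q'(1) u])
          show "(u, hd q') \<in> arcs_ends G"
            using p'(1) q'(3) ends len m unfolding vwalk_iff_nth by fastforce
        qed
        moreover have "hd q' = (u # q') ! 1" "last (u # q') = p ! m"
          using q' m by (auto simp: hd_conv_nth)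
        moreover have "q ! 1 = p ! 1" using nth_q m by simp
        moreover have "vertex_shelling_cond G r m" using less.IH m by simp
        ultimately obtain j w where "j \<in> {1..<m}" "w \<in> verts G" "(w, q ! j) \<in> r"
          "q ! (j - 1) \<rightarrow>\<^bsub>G\<^esub> w" "w \<rightarrow>\<^bsub>G\<^esub> q ! (j + 1)"
          unfolding vertex_shelling_cond_def
          using u lt(2) q'(2,3) len_q less1 unfolding verts
          by (metis diff_Suc_1 last_ConsL length_Cons lessThan_iff list.sel(1) vwalk_length_simp)
        \<comment> \<open>Since \<open>j < m\<close>, the positions \<open>j - 1\<close>,
          \<open>j\<close> and \<open>j + 1\<close> all lie in the prefix \<open>q\<close>, where it
          agrees with \<open>p\<close>; the same \<open>j\<close> and \<open>w\<close> therefore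
          work for \<open>p\<close>.\<close>
        with m nth_q show "\<exists>j\<in>{1..<k}. \<exists>w\<in>verts G.
            (w, p ! j) \<in> r \<and> p ! (j - 1) \<rightarrow>\<^bsub>G\<^esub> w \<and> w \<rightarrow>\<^bsub>G\<^esub> p ! (j + 1)"
          by (intro bexI[of _ j] bexI[of _ w]) auto
      qed
    qed
  qed
  with assms(8) show "vertex_shelling_order G r" by (simp add: vertex_shelling_order_def)
qed

end
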